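(* Let $(Q,\cdot)$ be a quasigroup, and let ${}_1\theta^A_l,{}_3\theta^A_l$, ${}_2\theta^A_r,{}_3\theta^A_r$, ${}_1\theta^A_m,{}_2\theta^A_m$ be the pairs of equivalences on $Q$ determined by subgroups of ${}_1N^A_l$, ${}_2N^A_r$, ${}_1N^A_m$ respectively (as defined in the context). 1. If ${}_1\theta^A_l={}_3\theta^A_l=:\theta^A_l$, then this equivalence is normal from the right. 2. If ${}_2\theta^A_r={}_3\theta^A_r=:\theta^A_r$, then this equivalence is normal from the left. 3. If ${}_1\theta^A_m={}_2\theta^A_m=:\theta^A_m$, then this equivalence is stable relative to all middle translations and their inverses. 4. If ${}_1\theta^A_l={}_3\theta^A_l=\theta^A_l$, ${}_2\theta^A_r={}_3\theta^A_r=\theta^A_r$ and $\theta^A_l=\theta^A_r$, then ${}_1\theta^A_l,{}_3\theta^A_l,{}_2\theta^A_r,{}_3\theta^A_r$ are normal congruences. 5. If ${}_1\theta^A_l={}_3\theta^A_l=\theta^A_l$, ${}_1\theta^A_m={}_2\theta^A_m=\theta^A_m$ and $\theta^A_l=\theta^A_m$, then ${}_1\theta^A_l,{}_3\theta^A_l,{}_1\theta^A_m,{}_2\theta^A_m$ are normal congruences. 6. If ${}_2\theta^A_r={}_3\theta^A_r=\theta^A_r$, ${}_1\theta^A_m={}_2\theta^A_m=\theta^A_m$ and $\theta^A_r=\theta^A_m$, then ${}_2\theta^A_r,{}_3\theta^A_r,{}_1\theta^A_m,{}_2\theta^A_m$ are normal congruences.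
   Context: A quasigroup $(Q,\cdot)$ is a non-empty set $Q$ with a binary operation such that for all $a,b\in Q$ the equations $x\cdot a=b$ and $a\cdot y=b$ each have a unique solution. Translations: $L_ax=a\cdot x$, $R_ax=x\cdot a$, and the middle translation $P_a$ defined by $x\cdot P_ax=a$; all are permutations of $Q$. Maps compose as $(\mu\nu)(x)=\mu(\nu(x))$; $\varepsilon$ is the identity permutation. An autotopy is a triple $(\alpha,\beta,\gamma)$ of permutations of $Q$ with $\alpha x\cdot\beta y=\gamma(x\cdot y)$ for all $x,y$. $N^A_l,N^A_r,N^A_m$ are the groups of autotopies of the forms $(\alpha,\varepsilon,\gamma)$, $(\varepsilon,\beta,\gamma)$, $(\alpha,\beta,\varepsilon)$ respectively; ${}_iN^A_l$, ${}_iN^A_r$, ${}_iN^A_m$ is the group of $i$-th components of their elements. Equivalences. If $K$ is a subgroup of ${}_1N^A_l$, then $R_xKR_x^{-1}$ is a subgroup of ${}_3N^A_l$ not depending on $x\in Q$; ${}_1\theta^A_l$ denotes the equivalence on $Q$ whose classes are the orbits of $K$, and ${}_3\theta^A_l$ the one whose classes are the orbits of $R_xKR_x^{-1}$. Similarly, for a subgroup $K$ of ${}_2N^A_r$, ${}_2\theta^A_r$ and ${}_3\theta^A_r$ are the orbit equivalences of $K$ and of $L_xKL_x^{-1}\subseteq{}_3N^A_r$; for a subgroup $K$ of ${}_1N^A_m$, ${}_1\theta^A_m$ and ${}_2\theta^A_m$ are the orbit equivalences of $K$ and of $P_xKP_x^{-1}\subseteq{}_2N^A_m$ (again independent of $x$).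 The subgroups chosen in the left, right and middle cases are arbitrary. An equivalence $\theta$ is stable relative to a map $\omega$ if $x\,\theta\,y\Rightarrow\omega x\,\theta\,\omega y$. It is normal from the right if for all $x,y,z$: $x\,\theta\,y\Leftrightarrow (x\cdot z)\,\theta\,(y\cdot z)$; normal from the left if for all $x,y,z$: $x\,\theta\,y\Leftrightarrow(z\cdot x)\,\theta\,(z\cdot y)$; a normal congruence if it is normal from the right and from the left. *)

theory Defs
  imports "HOL-Algebra.Bij" "HOL-Algebra.Group_Action"
begin

section \<open>Quasigroups and translations\<close>

text \<open>Permutations of the carrier \<open>Q\<close> are the elements of \<open>BijGroup Q\<close>: they are undefined
  outside \<open>Q\<close>, its unit is the identity on \<open>Q\<close>, and its product is
  \<open>(\<mu> \<nu>) x = \<mu> (\<nu> x)\<close>. All maps below are restricted to \<open>Q\<close> accordingly.\<close>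

locale quasigroup =
  fixes Q :: "'a set" and f :: "'a \<Rightarrow> 'a \<Rightarrow> 'a" (infixl "\<cdot>" 70)
  assumes nonempty: "Q \<noteq> {}"
    and closed: "\<lbrakk>a \<in> Q; b \<in> Q\<rbrakk> \<Longrightarrow> a \<cdot> b \<in> Q"
    and ex1_left: "\<lbrakk>a \<in> Q; b \<in> Q\<rbrakk> \<Longrightarrow> \<exists>!x. x \<in> Q \<and> x \<cdot> a = b"
    and ex1_right: "\<lbrakk>a \<in> Q; b \<in> Q\<rbrakk> \<Longrightarrow> \<exists>!y. y \<in> Q \<and> a \<cdot> y = b"

definition left_trans :: "'a set \<Rightarrow> ('a \<Rightarrow> 'a \<Rightarrow> 'a) \<Rightarrow> 'a \<Rightarrow> 'a \<Rightarrow> 'a" where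
  "left_trans Q f a = (\<lambda>x\<in>Q. f a x)"

definition right_trans :: "'a set \<Rightarrow> ('a \<Rightarrow> 'a \<Rightarrow> 'a) \<Rightarrow> 'a \<Rightarrow> 'a \<Rightarrow> 'a" where
  "right_trans Q f a = (\<lambda>x\<in>Q. f x a)"

definition middle_trans :: "'a set \<Rightarrow> ('a \<Rightarrow> 'a \<Rightarrow> 'a) \<Rightarrow> 'a \<Rightarrow> 'a \<Rightarrow> 'a" where
  "middle_trans Q f a = (\<lambda>x\<in>Q. THE y. y \<in> Q \<and> f x y = a)"


section \<open>Autotopies and nuclear components\<close>

definition autotopies ::
  "'a set \<Rightarrow> ('a \<Rightarrow> 'a \<Rightarrow> 'a) \<Rightarrow> (('a \<Rightarrow> 'a) \<times> ('a \<Rightarrow> 'a) \<times> ('a \<Rightarrow> 'a)) set" where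
  "autotopies Q f = {(\<alpha>, \<beta>, \<gamma>). \<alpha> \<in> Bij Q \<and> \<beta> \<in> Bij Q \<and> \<gamma> \<in> Bij Q \<and>
     (\<forall>x\<in>Q. \<forall>y\<in>Q. f (\<alpha> x) (\<beta> y) = \<gamma> (f x y))}"

definition A_nucleus_l ::
  "'a set \<Rightarrow> ('a \<Rightarrow> 'a \<Rightarrow> 'a) \<Rightarrow> (('a \<Rightarrow> 'a) \<times> ('a \<Rightarrow> 'a) \<times> ('a \<Rightarrow> 'a)) set" where
  "A_nucleus_l Q f = {(\<alpha>, \<beta>, \<gamma>) \<in> autotopies Q f. \<beta> = \<one>\<^bsub>BijGroup Q\<^esub>}"

definition A_nucleus_r ::
  "'a set \<Rightarrow> ('a \<Rightarrow> 'a \<Rightarrow> 'a) \<Rightarrow> (('a \<Rightarrow> 'a) \<times> ('a \<Rightarrow> 'a) \<times> ('a \<Rightarrow> 'a)) set" where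
  "A_nucleus_r Q f = {(\<alpha>, \<beta>, \<gamma>) \<in> autotopies Q f. \<alpha> = \<one>\<^bsub>BijGroup Q\<^esub>}"

definition A_nucleus_m ::
  "'a set \<Rightarrow> ('a \<Rightarrow> 'a \<Rightarrow> 'a) \<Rightarrow> (('a \<Rightarrow> 'a) \<times> ('a \<Rightarrow> 'a) \<times> ('a \<Rightarrow> 'a)) set" where
  "A_nucleus_m Q f = {(\<alpha>, \<beta>, \<gamma>) \<in> autotopies Q f. \<gamma> = \<one>\<^bsub>BijGroup Q\<^esub>}"

definition component1 :: "('b \<times> 'c \<times> 'd) set \<Rightarrow> 'b set" where
  "component1 T = (\<lambda>(\<alpha>, \<beta>, \<gamma>). \<alpha>) ` T"

definition component2 :: "('b \<times> 'c \<times> 'd) set \<Rightarrow> 'c set" where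
  "component2 T = (\<lambda>(\<alpha>, \<beta>, \<gamma>). \<beta>) ` T"

definition component3 :: "('b \<times> 'c \<times> 'd) set \<Rightarrow> 'd set" where
  "component3 T = (\<lambda>(\<alpha>, \<beta>, \<gamma>). \<gamma>) ` T"

definition perm_group :: "'a set \<Rightarrow> ('a \<Rightarrow> 'a) set \<Rightarrow> ('a \<Rightarrow> 'a) monoid" where
  "perm_group Q H = BijGroup Q \<lparr>carrier := H\<rparr>"


section \<open>The orbit equivalences\<close>

definition orbit_equiv :: "'a set \<Rightarrow> ('a \<Rightarrow> 'a) set \<Rightarrow> ('a \<times> 'a) set" where
  "orbit_equiv Q H = {(x, y). x \<in> Q \<and> y \<in> orbit (perm_group Q H) (\<lambda>h. h) x}"

definition conjugate :: "'a set \<Rightarrow> ('a \<Rightarrow> 'a) \<Rightarrow> ('a \<Rightarrow> 'a) set \<Rightarrow> ('a \<Rightarrow> 'a) set" where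
  "conjugate Q \<sigma> H = (\<sigma> <#\<^bsub>BijGroup Q\<^esub> H) #>\<^bsub>BijGroup Q\<^esub> inv\<^bsub>BijGroup Q\<^esub> \<sigma>"

text \<open>The conjugated subgroups are formed with an explicit base point \<open>x\<close>; the lemmas
  \<open>conjugate_right_trans_indep\<close>, \<open>conjugate_left_trans_indep\<close> and
  \<open>conjugate_middle_trans_indep\<close> below show that they do not depend on it.\<close>

definition theta1_l :: "'a set \<Rightarrow> ('a \<Rightarrow> 'a) set \<Rightarrow> ('a \<times> 'a) set" where
  "theta1_l Q K = orbit_equiv Q K"

definition theta3_l ::
  "'a set \<Rightarrow> ('a \<Rightarrow> 'a \<Rightarrow> 'a) \<Rightarrow> ('a \<Rightarrow> 'a) set \<Rightarrow> 'a \<Rightarrow> ('a \<times> 'a) set" where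
  "theta3_l Q f K x = orbit_equiv Q (conjugate Q (right_trans Q f x) K)"

definition theta2_r :: "'a set \<Rightarrow> ('a \<Rightarrow> 'a) set \<Rightarrow> ('a \<times> 'a) set" where
  "theta2_r Q K = orbit_equiv Q K"

definition theta3_r ::
  "'a set \<Rightarrow> ('a \<Rightarrow> 'a \<Rightarrow> 'a) \<Rightarrow> ('a \<Rightarrow> 'a) set \<Rightarrow> 'a \<Rightarrow> ('a \<times> 'a) set" where
  "theta3_r Q f K x = orbit_equiv Q (conjugate Q (left_trans Q f x) K)"

definition theta1_m :: "'a set \<Rightarrow> ('a \<Rightarrow> 'a) set \<Rightarrow> ('a \<times> 'a) set" where
  "theta1_m Q K = orbit_equiv Q K"

definition theta2_m ::
  "'a set \<Rightarrow> ('a \<Rightarrow> 'a \<Rightarrow> 'a) \<Rightarrow> ('a \<Rightarrow> 'a) set \<Rightarrow> 'a \<Rightarrow> ('a \<times> 'a) set" where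
  "theta2_m Q f K x = orbit_equiv Q (conjugate Q (middle_trans Q f x) K)"


section \<open>Stability and normality\<close>

text \<open>That \<open>\<theta>\<close> is an equivalence on \<open>Q\<close> is part of each of these notions.\<close>

definition stable_rel :: "'a set \<Rightarrow> ('a \<times> 'a) set \<Rightarrow> ('a \<Rightarrow> 'a) \<Rightarrow> bool" where
  "stable_rel Q \<theta> \<omega> \<longleftrightarrow> equiv Q \<theta> \<and>
     (\<forall>x\<in>Q. \<forall>y\<in>Q. (x, y) \<in> \<theta> \<longrightarrow> (\<omega> x, \<omega> y) \<in> \<theta>)"

definition normal_from_right :: "'a set \<Rightarrow> ('a \<Rightarrow> 'a \<Rightarrow> 'a) \<Rightarrow> ('a \<times> 'a) set \<Rightarrow> bool" where
  "normal_from_right Q f \<theta> \<longleftrightarrow> equiv Q \<theta> \<and>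
     (\<forall>x\<in>Q. \<forall>y\<in>Q. \<forall>z\<in>Q. (x, y) \<in> \<theta> \<longleftrightarrow> (f x z, f y z) \<in> \<theta>)"

definition normal_from_left :: "'a set \<Rightarrow> ('a \<Rightarrow> 'a \<Rightarrow> 'a) \<Rightarrow> ('a \<times> 'a) set \<Rightarrow> bool" where
  "normal_from_left Q f \<theta> \<longleftrightarrow> equiv Q \<theta> \<and>
     (\<forall>x\<in>Q. \<forall>y\<in>Q. \<forall>z\<in>Q. (x, y) \<in> \<theta> \<longleftrightarrow> (f z x, f z y) \<in> \<theta>)"

definition normal_congruence :: "'a set \<Rightarrow> ('a \<Rightarrow> 'a \<Rightarrow> 'a) \<Rightarrow> ('a \<times> 'a) set \<Rightarrow> bool" where
  "normal_congruence Q f \<theta> \<longleftrightarrow> normal_from_right Q f \<theta> \<and> normal_from_left Q f \<theta>"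


section \<open>Independence of the base point\<close>

lemma BijI: "\<lbrakk>g \<in> extensional Q; \<And>x. x \<in> Q \<Longrightarrow> g x \<in> Q; \<And>b. b \<in> Q \<Longrightarrow> \<exists>!x. x \<in> Q \<and> g x = b\<rbrakk>
   \<Longrightarrow> g \<in> Bij Q"
  unfolding Bij_def bij_betw_def inj_on_def by (auto simp: image_iff) metis+

context quasigroup
begin

lemma left_trans_Bij: "a \<in> Q \<Longrightarrow> left_trans Q f a \<in> Bij Q"
proof (rule BijI)
  fix b assume "a \<in> Q" "b \<in> Q"
  then show "\<exists>!x. x \<in> Q \<and> left_trans Q f a x = b"
    using ex1_right[of a b] by (simp add: left_trans_def cong: conj_cong)
qed (auto simp: left_trans_def closed)

lemma right_trans_Bij: "a \<in> Q \<Longrightarrow> right_trans Q f a \<in> Bij Q"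
proof (rule BijI)
  fix b assume "a \<in> Q" "b \<in> Q"
  then show "\<exists>!x. x \<in> Q \<and> right_trans Q f a x = b"
    using ex1_left[of a b] by (simp add: right_trans_def cong: conj_cong)
qed (auto simp: right_trans_def closed)

lemma middle_trans_eq_iff:
  assumes "a \<in> Q" "x \<in> Q" "y \<in> Q"
  shows "middle_trans Q f a x = y \<longleftrightarrow> x \<cdot> y = a"
  using theI'[OF ex1_right[OF assms(2,1)]] ex1_right[OF assms(2,1)] assms
  unfolding middle_trans_def by auto

lemma middle_trans_closed: "\<lbrakk>a \<in> Q; x \<in> Q\<rbrakk> \<Longrightarrow> middle_trans Q f a x \<in> Q"
  using theI'[OF ex1_right] unfolding middle_trans_def by auto

lemma middle_trans_Bij: "a \<in> Q \<Longrightarrow> middle_trans Q f a \<in> Bij Q"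
proof (rule BijI)
  fix b assume "a \<in> Q" "b \<in> Q"
  then show "\<exists>!x. x \<in> Q \<and> middle_trans Q f a x = b"
    using ex1_left[of b a] by (simp add: middle_trans_eq_iff cong: conj_cong)
qed (auto simp: middle_trans_closed, simp add: middle_trans_def)

end

lemma conjugate_eqI:
  assumes s: "\<sigma> \<in> Bij Q"
    and T: "\<And>\<alpha> \<gamma>. (\<alpha>, \<gamma>) \<in> S \<Longrightarrow> \<alpha> \<in> Bij Q \<and> \<gamma> \<in> Bij Q \<and> (\<forall>y\<in>Q. \<sigma> (\<alpha> y) = \<gamma> (\<sigma> y))"
    and S: "\<And>\<alpha>. \<alpha> \<in> H \<Longrightarrow> \<exists>\<gamma>. (\<alpha>, \<gamma>) \<in> S"
  shows "conjugate Q \<sigma> H = S `` H"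
proof -
  interpret B: group "BijGroup Q" by (rule group_BijGroup)
  have key: "\<sigma> \<otimes>\<^bsub>BijGroup Q\<^esub> \<alpha> \<otimes>\<^bsub>BijGroup Q\<^esub> inv\<^bsub>BijGroup Q\<^esub> \<sigma> = \<gamma>" if "(\<alpha>, \<gamma>) \<in> S" for \<alpha> \<gamma>
  proof -
    have c: "\<alpha> \<in> carrier (BijGroup Q)" "\<gamma> \<in> carrier (BijGroup Q)" "\<sigma> \<in> carrier (BijGroup Q)"
      using T[OF that] s by (auto simp: BijGroup_def)
    have "\<sigma> \<otimes>\<^bsub>BijGroup Q\<^esub> \<alpha> = \<gamma> \<otimes>\<^bsub>BijGroup Q\<^esub> \<sigma>"
      using T[OF that] s by (auto simp: BijGroup_def compose_def)
    then show ?thesis using c by (simp add: B.m_assoc)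
  qed
  show ?thesis
    unfolding conjugate_def l_coset_def r_coset_def using key S by (fastforce simp: Image_def)
qed

context quasigroup
begin

lemma conjugate_right_trans:
  assumes "x \<in> Q" "K \<subseteq> component1 (A_nucleus_l Q f)"
  shows "conjugate Q (right_trans Q f x) K =
    {(\<alpha>, \<gamma>). (\<alpha>, \<one>\<^bsub>BijGroup Q\<^esub>, \<gamma>) \<in> A_nucleus_l Q f} `` K"
proof (rule conjugate_eqI[OF right_trans_Bij[OF assms(1)]])
  fix \<alpha> \<gamma> assume "(\<alpha>, \<gamma>) \<in> {(\<alpha>, \<gamma>). (\<alpha>, \<one>\<^bsub>BijGroup Q\<^esub>, \<gamma>) \<in> A_nucleus_l Q f}"
  then show "\<alpha> \<in> Bij Q \<and> \<gamma> \<in> Bij Q \<and>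
      (\<forall>y\<in>Q. right_trans Q f x (\<alpha> y) = \<gamma> (right_trans Q f x y))"
    using assms(1)
    by (auto simp: A_nucleus_l_def autotopies_def right_trans_def BijGroup_def
        Bij_imp_funcset[THEN funcset_mem])
qed (use assms in \<open>auto simp: component1_def A_nucleus_l_def\<close>)

lemma conjugate_left_trans:
  assumes "x \<in> Q" "K \<subseteq> component2 (A_nucleus_r Q f)"
  shows "conjugate Q (left_trans Q f x) K =
    {(\<beta>, \<gamma>). (\<one>\<^bsub>BijGroup Q\<^esub>, \<beta>, \<gamma>) \<in> A_nucleus_r Q f} `` K"
proof (rule conjugate_eqI[OF left_trans_Bij[OF assms(1)]])
  fix \<beta> \<gamma> assume "(\<beta>, \<gamma>) \<in> {(\<beta>, \<gamma>). (\<one>\<^bsub>BijGroup Q\<^esub>, \<beta>, \<gamma>) \<in> A_nucleus_r Q f}"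
  then show "\<beta> \<in> Bij Q \<and> \<gamma> \<in> Bij Q \<and>
      (\<forall>y\<in>Q. left_trans Q f x (\<beta> y) = \<gamma> (left_trans Q f x y))"
    using assms(1)
    by (auto simp: A_nucleus_r_def autotopies_def left_trans_def BijGroup_def
        Bij_imp_funcset[THEN funcset_mem])
qed (use assms in \<open>auto simp: component2_def A_nucleus_r_def\<close>)

lemma conjugate_middle_trans:
  assumes "x \<in> Q" "K \<subseteq> component1 (A_nucleus_m Q f)"
  shows "conjugate Q (middle_trans Q f x) K =
    {(\<alpha>, \<beta>). (\<alpha>, \<beta>, \<one>\<^bsub>BijGroup Q\<^esub>) \<in> A_nucleus_m Q f} `` K"
proof (rule conjugate_eqI[OF middle_trans_Bij[OF assms(1)]])
  fix \<alpha> \<beta> assume "(\<alpha>, \<beta>) \<in> {(\<alpha>, \<beta>). (\<alpha>, \<beta>, \<one>\<^bsub>BijGroup Q\<^esub>) \<in> A_nucleus_m Q f}"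
  then have ab: "\<alpha> \<in> Bij Q" "\<beta> \<in> Bij Q" "\<And>y z. y \<in> Q \<Longrightarrow> z \<in> Q \<Longrightarrow> \<alpha> y \<cdot> \<beta> z = y \<cdot> z"
    by (auto simp: A_nucleus_m_def autotopies_def BijGroup_def closed)
  then have "middle_trans Q f x (\<alpha> y) = \<beta> (middle_trans Q f x y)" if "y \<in> Q" for y
    using that assms(1) middle_trans_eq_iff[OF assms(1) that middle_trans_closed]
    by (subst middle_trans_eq_iff)
      (auto simp: middle_trans_closed Bij_imp_funcset[THEN funcset_mem])
  with ab show "\<alpha> \<in> Bij Q \<and> \<beta> \<in> Bij Q \<and>
      (\<forall>y\<in>Q. middle_trans Q f x (\<alpha> y) = \<beta> (middle_trans Q f x y))"
    by auto
qed (use assms in \<open>auto simp: component1_def A_nucleus_m_def\<close>)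

lemma conjugate_right_trans_indep:
  "\<lbrakk>K \<subseteq> component1 (A_nucleus_l Q f); x \<in> Q; y \<in> Q\<rbrakk> \<Longrightarrow>
    conjugate Q (right_trans Q f x) K = conjugate Q (right_trans Q f y) K"
  by (simp add: conjugate_right_trans)

lemma conjugate_left_trans_indep:
  "\<lbrakk>K \<subseteq> component2 (A_nucleus_r Q f); x \<in> Q; y \<in> Q\<rbrakk> \<Longrightarrow>
    conjugate Q (left_trans Q f x) K = conjugate Q (left_trans Q f y) K"
  by (simp add: conjugate_left_trans)

lemma conjugate_middle_trans_indep:
  "\<lbrakk>K \<subseteq> component1 (A_nucleus_m Q f); x \<in> Q; y \<in> Q\<rbrakk> \<Longrightarrow>
    conjugate Q (middle_trans Q f x) K = conjugate Q (middle_trans Q f y) K"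
  by (simp add: conjugate_middle_trans)

end

end

theory Submission
  imports Defs
begin

text \<open>
  The first coordinates, say, of the autotopies in a nucleus form a subgroup of the symmetric
  group of \<open>Q\<close>, so orbits of a subgroup \<open>K\<close> of it do form an equivalence. For any permutation
  \<open>\<sigma>\<close> of \<open>Q\<close>, the points \<open>x\<close> and \<open>y\<close> lie in one orbit of \<open>K\<close> iff \<open>\<sigma> x\<close> and \<open>\<sigma> y\<close> lie in one
  orbit of \<open>\<sigma> K \<sigma>\<^sup>-\<^sup>1\<close> (\<open>orbit_equiv_conjugate\<close>). Hence, if the two groups have the same orbits,
  their common orbit equivalence \<open>\<theta>\<close> satisfies \<open>x \<theta> y \<longleftrightarrow> \<sigma> x \<theta> \<sigma> y\<close>. The conjugates of \<open>K\<close> by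
  right translations all coincide, and the same holds for left and for middle translations, so
  this applies to every translation \<open>\<sigma>\<close> of the respective kind. This gives the first
  three claims, and the fourth is the conjunction of the first two.

  For the last two claims, \<open>x \<cdot> z = a\<close> means \<open>P\<^sub>a x = z\<close>. If every
  \<open>P\<^sub>a\<close> preserves and reflects \<open>\<theta>\<close>, then whenever \<open>x \<cdot> z = x' \<cdot> z'\<close>, the relations \<open>x \<theta> x'\<close> and
  \<open>z \<theta> z'\<close> are equivalent. This trades a change of the left factor for a change of the right
  factor, so that normality from one side yields normality from the other.
\<close>

section \<open>Components of the nuclei are groups\<close>

lemma subgroup_components:
  assumes "group G" "group H" "group I" and T: "subgroup T (G \<times>\<times> H \<times>\<times> I)"
  shows "subgroup (component1 T) G" and "subgroup (component2 T) H"
proof -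
  have g: "group (G \<times>\<times> H \<times>\<times> I)"
    using assms(1-3) by (intro DirProd_group)
  have "group_hom (G \<times>\<times> H \<times>\<times> I) G (\<lambda>(\<alpha>, \<beta>, \<gamma>). \<alpha>)"
    "group_hom (G \<times>\<times> H \<times>\<times> I) H (\<lambda>(\<alpha>, \<beta>, \<gamma>). \<beta>)"
    using g assms(1-3) by (auto simp: group_hom_def group_hom_axioms_def hom_def)
  then show "subgroup (component1 T) G" "subgroup (component2 T) H"
    unfolding component1_def component2_def
    by (blast intro: group_hom.subgroup_img_is_subgroup T)+
qed

lemma Bij_closed: "\<lbrakk>g \<in> Bij Q; x \<in> Q\<rbrakk> \<Longrightarrow> g x \<in> Q"
  by (rule Bij_imp_funcset[THEN funcset_mem])

lemma BijGroup_carrier [simp]: "carrier (BijGroup Q) = Bij Q"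
  by (simp add: BijGroup_def)

lemma BijGroup_one_apply: "x \<in> Q \<Longrightarrow> \<one>\<^bsub>BijGroup Q\<^esub> x = x"
  by (simp add: BijGroup_def)

lemma BijGroup_mult_apply:
  "\<lbrakk>g \<in> Bij Q; h \<in> Bij Q; x \<in> Q\<rbrakk> \<Longrightarrow> (g \<otimes>\<^bsub>BijGroup Q\<^esub> h) x = g (h x)"
  by (simp add: BijGroup_def compose_eq)

lemma BijGroup_inv_closed: "g \<in> Bij Q \<Longrightarrow> inv\<^bsub>BijGroup Q\<^esub> g \<in> Bij Q"
  using group.inv_closed[OF group_BijGroup, of g Q] by simp

lemma BijGroup_apply_inv: "\<lbrakk>g \<in> Bij Q; x \<in> Q\<rbrakk> \<Longrightarrow> g ((inv\<^bsub>BijGroup Q\<^esub> g) x) = x"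
  using group.r_inv[OF group_BijGroup, of g Q]
  by (metis BijGroup_carrier BijGroup_inv_closed BijGroup_mult_apply BijGroup_one_apply)

lemma BijGroup_inv_apply: "\<lbrakk>g \<in> Bij Q; x \<in> Q\<rbrakk> \<Longrightarrow> (inv\<^bsub>BijGroup Q\<^esub> g) (g x) = x"
  using group.l_inv[OF group_BijGroup, of g Q]
  by (metis BijGroup_carrier BijGroup_inv_closed BijGroup_mult_apply BijGroup_one_apply)

context quasigroup
begin

lemma subgroup_autotopies:
  "subgroup (autotopies Q f) (BijGroup Q \<times>\<times> BijGroup Q \<times>\<times> BijGroup Q)"
    (is "subgroup _ ?G")
proof -
  interpret B: group "BijGroup Q" by (rule group_BijGroup)
  interpret G: group ?G by (intro DirProd_group group_BijGroup)
  show ?thesis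
  proof (rule G.subgroupI)
    show "autotopies Q f \<subseteq> carrier ?G"
      by (auto simp: autotopies_def)
    have "\<one>\<^bsub>?G\<^esub> \<in> autotopies Q f"
      using B.one_closed by (auto simp: autotopies_def BijGroup_one_apply closed)
    then show "autotopies Q f \<noteq> {}" by blast
  next
    fix s assume "s \<in> autotopies Q f"
    then obtain \<alpha> \<beta> \<gamma> where s: "s = (\<alpha>, \<beta>, \<gamma>)" "\<alpha> \<in> Bij Q" "\<beta> \<in> Bij Q" "\<gamma> \<in> Bij Q"
      and eq: "\<And>x y. x \<in> Q \<Longrightarrow> y \<in> Q \<Longrightarrow> \<alpha> x \<cdot> \<beta> y = \<gamma> (x \<cdot> y)"
      by (auto simp: autotopies_def)
    let ?i = "\<lambda>g. inv\<^bsub>BijGroup Q\<^esub> g"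
    have "?i \<alpha> x \<cdot> ?i \<beta> y = ?i \<gamma> (x \<cdot> y)" if "x \<in> Q" "y \<in> Q" for x y
    proof -
      have m: "?i \<alpha> x \<in> Q" "?i \<beta> y \<in> Q"
        using s that by (auto intro: Bij_closed BijGroup_inv_closed)
      have "\<gamma> (?i \<alpha> x \<cdot> ?i \<beta> y) = x \<cdot> y"
        using eq[OF m] s that by (simp add: BijGroup_apply_inv)
      then show ?thesis
        using BijGroup_inv_apply[OF s(4) closed[OF m]] by simp
    qed
    then show "inv\<^bsub>?G\<^esub> s \<in> autotopies Q f"
      using s by (simp add: autotopies_def DirProd_group B.group_axioms BijGroup_inv_closed)
  next
    fix s t assume "s \<in> autotopies Q f" "t \<in> autotopies Q f"
    then show "s \<otimes>\<^bsub>?G\<^esub> t \<in> autotopies Q f"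
      using B.m_closed
      by (auto simp: autotopies_def BijGroup_mult_apply Bij_closed closed)
  qed
qed

lemma subgroup_A_nuclei:
  shows "subgroup (A_nucleus_l Q f) (BijGroup Q \<times>\<times> BijGroup Q \<times>\<times> BijGroup Q)"
    and "subgroup (A_nucleus_r Q f) (BijGroup Q \<times>\<times> BijGroup Q \<times>\<times> BijGroup Q)"
    and "subgroup (A_nucleus_m Q f) (BijGroup Q \<times>\<times> BijGroup Q \<times>\<times> BijGroup Q)"
proof -
  let ?B = "BijGroup Q" and ?e = "{\<one>\<^bsub>BijGroup Q\<^esub>}"
  interpret B: group ?B by (rule group_BijGroup)
  interpret G: group "?B \<times>\<times> ?B \<times>\<times> ?B" by (intro DirProd_group group_BijGroup)
  have box: "subgroup (autotopies Q f \<inter> H \<times> I \<times> J) (?B \<times>\<times> ?B \<times>\<times> ?B)"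
    if "subgroup H ?B" "subgroup I ?B" "subgroup J ?B" for H I J
    using that
    by (intro G.subgroups_Inter_pair subgroup_autotopies DirProd_subgroups DirProd_group
        group_BijGroup)
  have "A_nucleus_l Q f = autotopies Q f \<inter> Bij Q \<times> ?e \<times> Bij Q"
    "A_nucleus_r Q f = autotopies Q f \<inter> ?e \<times> Bij Q \<times> Bij Q"
    "A_nucleus_m Q f = autotopies Q f \<inter> Bij Q \<times> Bij Q \<times> ?e"
    by (auto simp: A_nucleus_l_def A_nucleus_r_def A_nucleus_m_def autotopies_def)
  then show "subgroup (A_nucleus_l Q f) (?B \<times>\<times> ?B \<times>\<times> ?B)"
    "subgroup (A_nucleus_r Q f) (?B \<times>\<times> ?B \<times>\<times> ?B)"
    "subgroup (A_nucleus_m Q f) (?B \<times>\<times> ?B \<times>\<times> ?B)"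
    using box B.triv_subgroup B.subgroup_self by simp_all
qed

lemma subgroup_nuclear_components:
  shows "subgroup (component1 (A_nucleus_l Q f)) (BijGroup Q)"
    and "subgroup (component2 (A_nucleus_r Q f)) (BijGroup Q)"
    and "subgroup (component1 (A_nucleus_m Q f)) (BijGroup Q)"
  by (rule subgroup_components[OF group_BijGroup group_BijGroup group_BijGroup]
      subgroup_A_nuclei)+

end

section \<open>Orbit equivalences and conjugation\<close>

lemma orbit_equiv_iff: "(x, y) \<in> orbit_equiv Q H \<longleftrightarrow> x \<in> Q \<and> (\<exists>h\<in>H. y = h x)"
  by (auto simp: orbit_equiv_def orbit_def perm_group_def)

lemma equiv_orbit_equiv:
  assumes "subgroup H (BijGroup Q)"
  shows "equiv Q (orbit_equiv Q H)"
proof -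
  interpret A: group_action "perm_group Q H" Q "\<lambda>h. h"
    using assms subgroup.subgroup_is_group[OF assms group_BijGroup] subgroup.subset[OF assms]
    by (auto simp: group_action_def group_hom_def group_hom_axioms_def hom_def perm_group_def
        group_BijGroup)
  have sub: "orbit_equiv Q H \<subseteq> Q \<times> Q"
    by (auto simp: orbit_equiv_def orbit_def intro: A.element_image)
  show ?thesis
  proof (rule equivI[OF sub])
    show "refl_on Q (orbit_equiv Q H)"
      by (simp add: refl_on_def orbit_equiv_def A.orbit_refl)
    show "sym (orbit_equiv Q H)"
      using sub by (auto simp: sym_def orbit_equiv_def intro: A.orbit_sym)
    show "trans (orbit_equiv Q H)"
      using sub unfolding trans_def orbit_equiv_def
      by (auto intro: A.orbit_trans)
  qed
qed

lemma orbit_equiv_conjugate: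
  assumes s: "\<sigma> \<in> Bij Q" and H: "H \<subseteq> Bij Q" and xy: "x \<in> Q" "y \<in> Q"
  shows "(\<sigma> x, \<sigma> y) \<in> orbit_equiv Q (conjugate Q \<sigma> H) \<longleftrightarrow> (x, y) \<in> orbit_equiv Q H"
proof -
  interpret B: group "BijGroup Q" by (rule group_BijGroup)
  have conj: "(\<sigma> \<otimes>\<^bsub>BijGroup Q\<^esub> h \<otimes>\<^bsub>BijGroup Q\<^esub> inv\<^bsub>BijGroup Q\<^esub> \<sigma>) (\<sigma> x) = \<sigma> (h x)"
    if "h \<in> H" for h
    using that H s xy B.m_closed[of \<sigma> h]
    by (auto simp: BijGroup_mult_apply BijGroup_inv_closed BijGroup_inv_apply Bij_closed)
  have "inj_on \<sigma> Q"
    using s by (simp add: Bij_def bij_betw_def)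
  then have "\<sigma> y = \<sigma> (h x) \<longleftrightarrow> y = h x" if "h \<in> H" for h
    using that H xy by (auto simp: inj_on_eq_iff Bij_closed subset_iff)
  moreover have "(\<sigma> x, \<sigma> y) \<in> orbit_equiv Q (conjugate Q \<sigma> H) \<longleftrightarrow> (\<exists>h\<in>H. \<sigma> y = \<sigma> (h x))"
    using s xy by (auto simp: orbit_equiv_iff conjugate_def l_coset_def r_coset_def conj Bij_closed)
  ultimately show ?thesis
    using xy by (auto simp: orbit_equiv_iff)
qed

section \<open>Equivalences invariant under translations\<close>

context quasigroup
begin

lemma theta_l_normal_from_right:
  assumes K: "subgroup K (perm_group Q (component1 (A_nucleus_l Q f)))" and u: "u \<in> Q"
    and eq: "theta1_l Q K = theta3_l Q f K u"
  shows "normal_from_right Q f (theta1_l Q K)"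
  unfolding normal_from_right_def
proof (intro conjI ballI)
  have sub: "subgroup K (BijGroup Q)"
    using K group.incl_subgroup[OF group_BijGroup subgroup_nuclear_components(1)]
    by (simp add: perm_group_def)
  then show "equiv Q (theta1_l Q K)"
    unfolding theta1_l_def by (rule equiv_orbit_equiv)
  fix x y z assume xyz: "x \<in> Q" "y \<in> Q" "z \<in> Q"
  have "K \<subseteq> component1 (A_nucleus_l Q f)"
    using subgroup.subset[OF K] by (simp add: perm_group_def)
  then have "theta1_l Q K = orbit_equiv Q (conjugate Q (right_trans Q f z) K)"
    using eq conjugate_right_trans_indep[OF _ u xyz(3)] by (simp add: theta3_l_def)
  then show "(x, y) \<in> theta1_l Q K \<longleftrightarrow> (x \<cdot> z, y \<cdot> z) \<in> theta1_l Q K"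
    using orbit_equiv_conjugate[OF right_trans_Bij[OF xyz(3)] _ xyz(1,2), of K]
      subgroup.subset[OF sub] xyz by (simp add: theta1_l_def right_trans_def)
qed

lemma theta_r_normal_from_left:
  assumes K: "subgroup K (perm_group Q (component2 (A_nucleus_r Q f)))" and u: "u \<in> Q"
    and eq: "theta2_r Q K = theta3_r Q f K u"
  shows "normal_from_left Q f (theta2_r Q K)"
  unfolding normal_from_left_def
proof (intro conjI ballI)
  have sub: "subgroup K (BijGroup Q)"
    using K group.incl_subgroup[OF group_BijGroup subgroup_nuclear_components(2)]
    by (simp add: perm_group_def)
  then show "equiv Q (theta2_r Q K)"
    unfolding theta2_r_def by (rule equiv_orbit_equiv)
  fix x y z assume xyz: "x \<in> Q" "y \<in> Q" "z \<in> Q"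
  have "K \<subseteq> component2 (A_nucleus_r Q f)"
    using subgroup.subset[OF K] by (simp add: perm_group_def)
  then have "theta2_r Q K = orbit_equiv Q (conjugate Q (left_trans Q f z) K)"
    using eq conjugate_left_trans_indep[OF _ u xyz(3)] by (simp add: theta3_r_def)
  then show "(x, y) \<in> theta2_r Q K \<longleftrightarrow> (z \<cdot> x, z \<cdot> y) \<in> theta2_r Q K"
    using orbit_equiv_conjugate[OF left_trans_Bij[OF xyz(3)] _ xyz(1,2), of K]
      subgroup.subset[OF sub] xyz by (simp add: theta2_r_def left_trans_def)
qed

text \<open>An equivalence on \<open>Q\<close> that every middle translation both preserves and reflects, that is,
  one stable relative to all middle translations and their inverses.\<close>

definition middle_invariant :: "('a \<times> 'a) set \<Rightarrow> bool" where
  "middle_invariant \<theta> \<longleftrightarrow> equiv Q \<theta> \<and>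
     (\<forall>a\<in>Q. \<forall>x\<in>Q. \<forall>y\<in>Q.
       (x, y) \<in> \<theta> \<longleftrightarrow> (middle_trans Q f a x, middle_trans Q f a y) \<in> \<theta>)"

lemma theta_m_middle_invariant:
  assumes K: "subgroup K (perm_group Q (component1 (A_nucleus_m Q f)))" and u: "u \<in> Q"
    and eq: "theta1_m Q K = theta2_m Q f K u"
  shows "middle_invariant (theta1_m Q K)"
  unfolding middle_invariant_def
proof (intro conjI ballI)
  have sub: "subgroup K (BijGroup Q)"
    using K group.incl_subgroup[OF group_BijGroup subgroup_nuclear_components(3)]
    by (simp add: perm_group_def)
  then show "equiv Q (theta1_m Q K)"
    unfolding theta1_m_def by (rule equiv_orbit_equiv)
  fix z x y assume xyz: "z \<in> Q" "x \<in> Q" "y \<in> Q"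
  have "K \<subseteq> component1 (A_nucleus_m Q f)"
    using subgroup.subset[OF K] by (simp add: perm_group_def)
  then have "theta1_m Q K = orbit_equiv Q (conjugate Q (middle_trans Q f z) K)"
    using eq conjugate_middle_trans_indep[OF _ u xyz(1)] by (simp add: theta2_m_def)
  then show "(x, y) \<in> theta1_m Q K \<longleftrightarrow>
      (middle_trans Q f z x, middle_trans Q f z y) \<in> theta1_m Q K"
    using orbit_equiv_conjugate[OF middle_trans_Bij[OF xyz(1)] _ xyz(2,3), of K]
      subgroup.subset[OF sub] by (simp add: theta1_m_def)
qed

lemma middle_invariant_imp_stable:
  assumes \<theta>: "middle_invariant \<theta>" and a: "a \<in> Q"
  shows "stable_rel Q \<theta> (middle_trans Q f a)"
    and "stable_rel Q \<theta> (inv\<^bsub>BijGroup Q\<^esub> (middle_trans Q f a))"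
proof -
  let ?P = "middle_trans Q f a" and ?P' = "inv\<^bsub>BijGroup Q\<^esub> (middle_trans Q f a)"
  note P = middle_trans_Bij[OF a]
  have e: "equiv Q \<theta>"
    and iff: "\<And>x y. \<lbrakk>x \<in> Q; y \<in> Q\<rbrakk> \<Longrightarrow> (x, y) \<in> \<theta> \<longleftrightarrow> (?P x, ?P y) \<in> \<theta>"
    using \<theta> a unfolding middle_invariant_def by blast+
  show "stable_rel Q \<theta> ?P"
    using e iff unfolding stable_rel_def by blast
  have "(?P' x, ?P' y) \<in> \<theta>" if "x \<in> Q" "y \<in> Q" "(x, y) \<in> \<theta>" for x y
    using that iff[of "?P' x" "?P' y"] P
    by (simp add: Bij_closed BijGroup_inv_closed BijGroup_apply_inv)
  with e show "stable_rel Q \<theta> ?P'"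
    unfolding stable_rel_def by blast
qed

text \<open>For a middle invariant \<open>\<theta>\<close>, two factorisations of the same element \<open>a\<close> have related left
  factors iff they have related right factors: \<open>P\<^sub>a\<close> maps the left factor to the right one.\<close>

lemma middle_invariant_factors:
  assumes "middle_invariant \<theta>" "x \<in> Q" "x' \<in> Q" "z \<in> Q" "z' \<in> Q" "x \<cdot> z = x' \<cdot> z'"
  shows "(x, x') \<in> \<theta> \<longleftrightarrow> (z, z') \<in> \<theta>"
proof -
  have a: "x \<cdot> z \<in> Q"
    using assms by (simp add: closed)
  have "middle_trans Q f (x \<cdot> z) x = z" "middle_trans Q f (x \<cdot> z) x' = z'"
    using assms a by (simp_all add: middle_trans_eq_iff)
  then show ?thesis
    using assms(1-3) a unfolding middle_invariant_def by metis
qed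

lemma normal_congruence_if_right_middle:
  assumes R: "normal_from_right Q f \<theta>" and M: "middle_invariant \<theta>"
  shows "normal_congruence Q f \<theta>"
proof -
  have e: "equiv Q \<theta>" using R by (simp add: normal_from_right_def)
  have "(x, y) \<in> \<theta> \<longleftrightarrow> (z \<cdot> x, z \<cdot> y) \<in> \<theta>" if q: "x \<in> Q" "y \<in> Q" "z \<in> Q" for x y z
  proof -
    \<comment> \<open>\<open>z \<cdot> x\<close> is refactored with right factor \<open>y\<close>, so that it differs from \<open>z \<cdot> y\<close> on the left.\<close>
    obtain t where t: "t \<in> Q" "t \<cdot> y = z \<cdot> x"
      using ex1_left[OF q(2) closed[OF q(3,1)]] by blast
    have "(x, y) \<in> \<theta> \<longleftrightarrow> (z, t) \<in> \<theta>"
      using middle_invariant_factors[OF M q(3) t(1) q(1,2)] t by simp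
    also have "\<dots> \<longleftrightarrow> (z \<cdot> y, t \<cdot> y) \<in> \<theta>"
      using R q(2,3) t(1) unfolding normal_from_right_def by blast
    also have "\<dots> \<longleftrightarrow> (z \<cdot> x, z \<cdot> y) \<in> \<theta>"
      using t e by (auto elim: equivE dest: symD)
    finally show ?thesis .
  qed
  with R e show ?thesis by (simp add: normal_congruence_def normal_from_left_def)
qed

lemma normal_congruence_if_left_middle:
  assumes L: "normal_from_left Q f \<theta>" and M: "middle_invariant \<theta>"
  shows "normal_congruence Q f \<theta>"
proof -
  have e: "equiv Q \<theta>" using L by (simp add: normal_from_left_def)
  have "(x, y) \<in> \<theta> \<longleftrightarrow> (x \<cdot> z, y \<cdot> z) \<in> \<theta>" if q: "x \<in> Q" "y \<in> Q" "z \<in> Q" for x y z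
  proof -
    \<comment> \<open>\<open>x \<cdot> z\<close> is refactored with left factor \<open>y\<close>, so that it differs from \<open>y \<cdot> z\<close> on the right.\<close>
    obtain t where t: "t \<in> Q" "y \<cdot> t = x \<cdot> z"
      using ex1_right[OF q(2) closed[OF q(1,3)]] by blast
    have "(x, y) \<in> \<theta> \<longleftrightarrow> (z, t) \<in> \<theta>"
      using middle_invariant_factors[OF M q(1,2,3) t(1)] t by simp
    also have "\<dots> \<longleftrightarrow> (y \<cdot> z, y \<cdot> t) \<in> \<theta>"
      using L q(2,3) t(1) unfolding normal_from_left_def by blast
    also have "\<dots> \<longleftrightarrow> (x \<cdot> z, y \<cdot> z) \<in> \<theta>"
      using t e by (auto elim: equivE dest: symD)
    finally show ?thesis .
  qed
  with L e show ?thesis by (simp add: normal_congruence_def normal_from_right_def)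
qed

end

theorem corollary4p24:
  fixes Q :: "'a set" and f :: "'a \<Rightarrow> 'a \<Rightarrow> 'a"
    and K\<^sub>l K\<^sub>r K\<^sub>m :: "('a \<Rightarrow> 'a) set" and u v w :: 'a
  assumes "quasigroup Q f"
    and "subgroup K\<^sub>l (perm_group Q (component1 (A_nucleus_l Q f)))"
    and "subgroup K\<^sub>r (perm_group Q (component2 (A_nucleus_r Q f)))"
    and "subgroup K\<^sub>m (perm_group Q (component1 (A_nucleus_m Q f)))"
    and "u \<in> Q" "v \<in> Q" "w \<in> Q"
  shows "(theta1_l Q K\<^sub>l = theta3_l Q f K\<^sub>l u \<longrightarrow>
            normal_from_right Q f (theta1_l Q K\<^sub>l)) \<and>
         (theta2_r Q K\<^sub>r = theta3_r Q f K\<^sub>r v \<longrightarrow>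
            normal_from_left Q f (theta2_r Q K\<^sub>r)) \<and>
         (theta1_m Q K\<^sub>m = theta2_m Q f K\<^sub>m w \<longrightarrow>
            (\<forall>a\<in>Q. stable_rel Q (theta1_m Q K\<^sub>m) (middle_trans Q f a) \<and>
                    stable_rel Q (theta1_m Q K\<^sub>m) (inv\<^bsub>BijGroup Q\<^esub> (middle_trans Q f a)))) \<and>
         (theta1_l Q K\<^sub>l = theta3_l Q f K\<^sub>l u \<and> theta2_r Q K\<^sub>r = theta3_r Q f K\<^sub>r v \<and>
            theta1_l Q K\<^sub>l = theta2_r Q K\<^sub>r \<longrightarrow>
            normal_congruence Q f (theta1_l Q K\<^sub>l) \<and> normal_congruence Q f (theta3_l Q f K\<^sub>l u) \<and>
            normal_congruence Q f (theta2_r Q K\<^sub>r) \<and> normal_congruence Q f (theta3_r Q f K\<^sub>r v)) \<and>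
         (theta1_l Q K\<^sub>l = theta3_l Q f K\<^sub>l u \<and> theta1_m Q K\<^sub>m = theta2_m Q f K\<^sub>m w \<and>
            theta1_l Q K\<^sub>l = theta1_m Q K\<^sub>m \<longrightarrow>
            normal_congruence Q f (theta1_l Q K\<^sub>l) \<and> normal_congruence Q f (theta3_l Q f K\<^sub>l u) \<and>
            normal_congruence Q f (theta1_m Q K\<^sub>m) \<and> normal_congruence Q f (theta2_m Q f K\<^sub>m w)) \<and>
         (theta2_r Q K\<^sub>r = theta3_r Q f K\<^sub>r v \<and> theta1_m Q K\<^sub>m = theta2_m Q f K\<^sub>m w \<and>
            theta2_r Q K\<^sub>r = theta1_m Q K\<^sub>m \<longrightarrow>
            normal_congruence Q f (theta2_r Q K\<^sub>r) \<and> normal_congruence Q f (theta3_r Q f K\<^sub>r v) \<and>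
            normal_congruence Q f (theta1_m Q K\<^sub>m) \<and> normal_congruence Q f (theta2_m Q f K\<^sub>m w))"
proof -
  interpret quasigroup Q f by fact
  note l = theta_l_normal_from_right[OF assms(2,5)]
    and r = theta_r_normal_from_left[OF assms(3,6)]
    and m = theta_m_middle_invariant[OF assms(4,7)]
  have "normal_congruence Q f \<theta>" if "normal_from_right Q f \<theta>" "normal_from_left Q f \<theta>" for \<theta>
    using that by (simp add: normal_congruence_def)
  then show ?thesis
    using l r m
    by (auto intro: middle_invariant_imp_stable normal_congruence_if_right_middle
        normal_congruence_if_left_middle)
qed

end
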